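(* Let $A$ be a real $2\times 2$ matrix and let $X(t)=\begin{pmatrix} r(t)\cos(\theta(t))\\ r(t)\sin(\theta(t))\end{pmatrix}$ be a solution of $\frac{dX}{dt}=AX$. Then the radial velocity $dr/dt$ of $X(t)$ is given by $$\frac{dr}{dt}=r\,\mathcal{R}(\theta),$$ and the tangential velocity $r\,d\theta/dt$ of $X(t)$ is given by $$r\frac{d\theta}{dt}=r\,\mathcal{T}(\theta).$$ Whenever $X(t)\in S^1$ (the unit circle $r=1$), the angular velocity $d\theta/dt$ coincides with the tangential velocity, and $$\frac{dr}{dt}=\mathcal{R}(\theta),\qquad \frac{d\theta}{dt}=\mathcal{T}(\theta).$$
   Context: For a real matrix $A=\begin{pmatrix} a_{11} & a_{12}\\ a_{21} & a_{22}\end{pmatrix}$ put $m_R=\tfrac12(a_{11}+a_{22})$, $m_T=\tfrac12(a_{21}-a_{12})$, $p=\tfrac12\sqrt{(a_{11}-a_{22})^2+(a_{12}+a_{21})^2}$ and, if $p\ne0$, $\theta_R=\tfrac12\arctan(a_{12}+a_{21},a_{11}-a_{22})\in\mathbb{R}\pmod\pi$, where $\arctan(y,x)\in\mathbb{R}\pmod{2\pi}$ is the polar angle of $(x,y)$. The radial and tangential functions are $\mathcal{R}(\theta)=m_R+p\cos(2(\theta-\theta_R))$ and $\mathcal{T}(\theta)=m_T-p\sin(2(\theta-\theta_R))$ (when $p=0$: $\mathcal{R}\equiv m_R$, $\mathcal{T}\equiv m_T$). The polar coordinates $r(t)\ge 0$ and $\theta(t)$ of the solution are understood to be differentiable functions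 of $t$. *)

theory Defs
  imports "HOL-Analysis.Analysis"
begin

text \<open>The entry in row \<open>i\<close> and column \<open>j\<close> of \<open>A :: real^2^2\<close> is \<open>A $ i $ j\<close>.\<close>

definition m_R :: "real^2^2 \<Rightarrow> real" where
  "m_R A = (A$1$1 + A$2$2) / 2"

definition m_T :: "real^2^2 \<Rightarrow> real" where
  "m_T A = (A$2$1 - A$1$2) / 2"

definition amp :: "real^2^2 \<Rightarrow> real" where
  "amp A = sqrt ((A$1$1 - A$2$2)\<^sup>2 + (A$1$2 + A$2$1)\<^sup>2) / 2"

text \<open>
  \<open>polar_angle y x\<close> is the polar angle of the point \<open>(x, y)\<close>, written \<open>arctan (y, x)\<close> with the
  ordinate first. It is a class modulo \<open>2 * pi\<close>; we take its representative in \<open>(-pi, pi]\<close>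
  (and \<open>0\<close> for the origin). Hence \<open>\<theta>_R\<close>, a class modulo \<open>pi\<close>, has its representative
  in \<open>(-pi/2, pi/2]\<close>. The lemmas at the end show that \<open>radial\<close> and \<open>tangential\<close> do not depend
  on this choice.
\<close>

definition polar_angle :: "real \<Rightarrow> real \<Rightarrow> real" where
  "polar_angle y x = Arg (Complex x y)"

definition \<theta>_R :: "real^2^2 \<Rightarrow> real" where
  "\<theta>_R A = polar_angle (A$1$2 + A$2$1) (A$1$1 - A$2$2) / 2"

text \<open>If \<open>amp A = 0\<close>, the oscillating terms vanish and the functions are the constants
  \<open>m_R A\<close> and \<open>m_T A\<close>.\<close>

definition radial :: "real^2^2 \<Rightarrow> real \<Rightarrow> real" where
  "radial A \<theta> = m_R A + amp A * cos (2 * (\<theta> - \<theta>_R A))"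

definition tangential :: "real^2^2 \<Rightarrow> real \<Rightarrow> real" where
  "tangential A \<theta> = m_T A - amp A * sin (2 * (\<theta> - \<theta>_R A))"

lemma two_periodic_shift:
  fixes \<theta> \<phi> \<psi> :: real and k :: int
  assumes "\<phi> = \<psi> + of_int k * pi"
  shows "cos (2 * (\<theta> - \<phi>)) = cos (2 * (\<theta> - \<psi>))"
    and "sin (2 * (\<theta> - \<phi>)) = sin (2 * (\<theta> - \<psi>))"
proof -
  have e: "2 * (\<theta> - \<phi>) = 2 * (\<theta> - \<psi>) - of_int k * (2 * pi)"
    using assms by (simp add: algebra_simps)
  have c: "cos (of_int k * (2 * pi)) = 1" and s: "sin (of_int k * (2 * pi)) = 0"
    using cos_int_2pin[of k] sin_int_2pin[of k] by (simp_all add: mult_ac)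
  show "cos (2 * (\<theta> - \<phi>)) = cos (2 * (\<theta> - \<psi>))"
    unfolding e cos_diff[of "2 * (\<theta> - \<psi>)"] c s by simp
  show "sin (2 * (\<theta> - \<phi>)) = sin (2 * (\<theta> - \<psi>))"
    unfolding e sin_diff[of "2 * (\<theta> - \<psi>)"] c s by simp
qed

lemma radial_representative:
  assumes "\<phi> = \<theta>_R A + of_int k * pi"
  shows "radial A \<theta> = m_R A + amp A * cos (2 * (\<theta> - \<phi>))"
  unfolding radial_def two_periodic_shift(1)[OF assms] ..

lemma tangential_representative:
  assumes "\<phi> = \<theta>_R A + of_int k * pi"
  shows "tangential A \<theta> = m_T A - amp A * sin (2 * (\<theta> - \<phi>))"
  unfolding tangential_def two_periodic_shift(2)[OF assms] ..

end

(* In the rotating orthonormal frame e = (cos \<theta>, sin \<theta>), e' = (-sin \<theta>, cos \<theta>), the radial and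
   tangential functions are e . A e and e' . A e, by the double angle formulas. The product rule gives
   X' = r' e + r \<theta>' e', and projecting the equation X' = A X = r A e onto the frame yields both
   velocities, including at times where r = 0. *)
theory Submission
  imports Defs
begin

text \<open>Polar form of the complex number \<open>?z\<close>: its modulus is
  \<open>2 * amp A\<close> and its argument is \<open>2 * \<theta>_R A\<close>. The degenerate case
  \<open>amp A = 0\<close> is covered, since then \<open>?z\<close> is 0 and \<open>rcis\<close>
  with modulus 0 vanishes at every angle.\<close>

lemma amp_cos_sin_\<theta>_R:
  "amp A * cos (2 * \<theta>_R A) = (A$1$1 - A$2$2) / 2"
  "amp A * sin (2 * \<theta>_R A) = (A$1$2 + A$2$1) / 2"
proof -
  let ?z = "Complex (A$1$1 - A$2$2) (A$1$2 + A$2$1)"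
  have amp: "amp A = cmod ?z / 2"
    by (simp add: amp_def cmod_def)
  have z: "rcis (cmod ?z) (2 * \<theta>_R A) = ?z"
    by (simp add: \<theta>_R_def polar_angle_def rcis_cmod_Arg)
  show "amp A * cos (2 * \<theta>_R A) = (A$1$1 - A$2$2) / 2"
    using arg_cong[OF z, of Re] by (simp add: amp)
  show "amp A * sin (2 * \<theta>_R A) = (A$1$2 + A$2$1) / 2"
    using arg_cong[OF z, of Im] by (simp add: amp)
qed

text \<open>After expanding the cosine of the difference, \<open>amp A\<close> and
  \<open>\<theta>_R A\<close> occur only in the two products computed above, so they can be traded
  for matrix entries.\<close>

lemma radial_eq_quadratic_form:
  "radial A \<theta> = A$1$1 * (cos \<theta>)\<^sup>2 + (A$1$2 + A$2$1) * (cos \<theta> * sin \<theta>) + A$2$2 * (sin \<theta>)\<^sup>2"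
proof -
  have "radial A \<theta> = m_R A + cos (2 * \<theta>) * (amp A * cos (2 * \<theta>_R A))
      + sin (2 * \<theta>) * (amp A * sin (2 * \<theta>_R A))"
    by (simp add: radial_def right_diff_distrib cos_diff algebra_simps)
  \<comment> \<open>The factor cos^2 + sin^2 = 1 makes the mean term homogeneous of degree two, like
    the others, so that coefficients can be compared. The two deletions in the last step keep
    \<open>simp\<close> from collapsing it back to 1.\<close>
  also have "\<dots> = (A$1$1 + A$2$2) / 2 * ((cos \<theta>)\<^sup>2 + (sin \<theta>)\<^sup>2)
      + ((cos \<theta>)\<^sup>2 - (sin \<theta>)\<^sup>2) * ((A$1$1 - A$2$2) / 2)
      + 2 * sin \<theta> * cos \<theta> * ((A$1$2 + A$2$1) / 2)"
    by (simp add: amp_cos_sin_\<theta>_R m_R_def cos_double[of \<theta>] sin_double[of \<theta>])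
  finally show ?thesis
    by (simp add: field_simps del: sin_cos_squared_add sin_cos_squared_add2)
qed

lemma tangential_eq_quadratic_form:
  "tangential A \<theta> = A$2$1 * (cos \<theta>)\<^sup>2 + (A$2$2 - A$1$1) * (cos \<theta> * sin \<theta>) - A$1$2 * (sin \<theta>)\<^sup>2"
proof -
  have "tangential A \<theta> = m_T A - sin (2 * \<theta>) * (amp A * cos (2 * \<theta>_R A))
      + cos (2 * \<theta>) * (amp A * sin (2 * \<theta>_R A))"
    by (simp add: tangential_def right_diff_distrib sin_diff algebra_simps)
  also have "\<dots> = (A$2$1 - A$1$2) / 2 * ((cos \<theta>)\<^sup>2 + (sin \<theta>)\<^sup>2)
      - 2 * sin \<theta> * cos \<theta> * ((A$1$1 - A$2$2) / 2)
      + ((cos \<theta>)\<^sup>2 - (sin \<theta>)\<^sup>2) * ((A$1$2 + A$2$1) / 2)"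
    by (simp add: amp_cos_sin_\<theta>_R m_T_def cos_double[of \<theta>] sin_double[of \<theta>])
  finally show ?thesis
    by (simp add: field_simps del: sin_cos_squared_add sin_cos_squared_add2)
qed

text \<open>The hypotheses say that a rotation matrix takes (x, y) to (u, v); its inverse is its
  transpose.\<close>

lemma solve_rotation:
  fixes c s :: real
  assumes unit: "c\<^sup>2 + s\<^sup>2 = 1" and u: "x * c - y * s = u" and v: "x * s + y * c = v"
  shows "x = c * u + s * v" "y = c * v - s * u"
proof -
  have "c * u + s * v = x * (c\<^sup>2 + s\<^sup>2)" "c * v - s * u = y * (c\<^sup>2 + s\<^sup>2)"
    unfolding u[symmetric] v[symmetric] by algebra+
  then show "x = c * u + s * v" "y = c * v - s * u"
    by (simp_all add: unit)
qed

theorem corollary2p4: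
  fixes A :: "real^2^2" and X :: "real \<Rightarrow> real^2"
    and r \<theta> :: "real \<Rightarrow> real" and I :: "real set"
  assumes "open I" and "is_interval I"
    and "\<And>t. t \<in> I \<Longrightarrow> r t \<ge> 0"
    and "\<And>t. t \<in> I \<Longrightarrow> r differentiable (at t)"
    and "\<And>t. t \<in> I \<Longrightarrow> \<theta> differentiable (at t)"
    and "\<And>t. t \<in> I \<Longrightarrow> X t = vector [r t * cos (\<theta> t), r t * sin (\<theta> t)]"
    and "\<And>t. t \<in> I \<Longrightarrow> (X has_vector_derivative (A *v X t)) (at t)"
  shows "\<forall>t\<in>I.
      deriv r t = r t * radial A (\<theta> t) \<and>
      r t * deriv \<theta> t = r t * tangential A (\<theta> t) \<and>
      (X t \<in> sphere 0 1 \<longrightarrow>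
        deriv \<theta> t = r t * deriv \<theta> t \<and>
        deriv r t = radial A (\<theta> t) \<and>
        deriv \<theta> t = tangential A (\<theta> t))"
proof
  fix t assume t: "t \<in> I"
  let ?c = "cos (\<theta> t)" and ?s = "sin (\<theta> t)"
  have dr: "(r has_real_derivative deriv r t) (at t)"
    and d\<theta>: "(\<theta> has_real_derivative deriv \<theta> t) (at t)"
    using assms(4,5)[OF t] DERIV_deriv_iff_real_differentiable by blast+
  have X: "X u $ 1 = r u * cos (\<theta> u)" "X u $ 2 = r u * sin (\<theta> u)" if "u \<in> I" for u
    using assms(6)[OF that] by simp_all
  have dX: "((\<lambda>u. X u $ i) has_real_derivative (A *v X t) $ i) (at t)" for i
    using bounded_linear.has_vector_derivative[OF bounded_linear_vec_nth assms(7)[OF t]]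
    by (simp add: has_real_derivative_iff_has_vector_derivative)
  \<comment> \<open>The polar formula for \<open>X\<close> holds only on \<open>I\<close>; as
    \<open>I\<close> is open, it holds near \<open>t\<close>, and the derivative carries
    over.\<close>
  have "((\<lambda>u. r u * cos (\<theta> u)) has_real_derivative (A *v X t) $ 1) (at t)"
    using has_field_derivative_transform_within_open[OF dX[of 1] assms(1) t X(1)] .
  moreover have "((\<lambda>u. r u * cos (\<theta> u)) has_real_derivative
      deriv r t * ?c - (r t * deriv \<theta> t) * ?s) (at t)"
    by (rule derivative_eq_intros dr d\<theta> refl)+ (simp add: algebra_simps)
  \<comment> \<open>\<open>e1\<close> and \<open>e2\<close> are the two coordinates of r' e + r
    \<theta>' e' = A X.\<close>
  ultimately have e1: "deriv r t * ?c - (r t * deriv \<theta> t) * ?s = (A *v X t) $ 1"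
    using DERIV_unique by blast
  have "((\<lambda>u. r u * sin (\<theta> u)) has_real_derivative (A *v X t) $ 2) (at t)"
    using has_field_derivative_transform_within_open[OF dX[of 2] assms(1) t X(2)] .
  moreover have "((\<lambda>u. r u * sin (\<theta> u)) has_real_derivative
      deriv r t * ?s + (r t * deriv \<theta> t) * ?c) (at t)"
    by (rule derivative_eq_intros dr d\<theta> refl)+ (simp add: algebra_simps)
  ultimately have e2: "deriv r t * ?s + (r t * deriv \<theta> t) * ?c = (A *v X t) $ 2"
    using DERIV_unique by blast
  \<comment> \<open>The unknowns are r' and the whole product r \<theta>', so solving never divides
    by r.\<close>
  note projections = solve_rotation[OF _ e1 e2, simplified]
  have AX: "(A *v X t) $ i = r t * (A$i$1 * ?c + A$i$2 * ?s)" for i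
    by (simp add: matrix_vector_mult_def sum_2 X[OF t] algebra_simps)
  have radial: "deriv r t = r t * radial A (\<theta> t)"
    unfolding projections(1) AX radial_eq_quadratic_form by algebra
  have tangential: "r t * deriv \<theta> t = r t * tangential A (\<theta> t)"
    unfolding projections(2) AX tangential_eq_quadratic_form by algebra
  \<comment> \<open>The norm determines only the square of \<open>r t\<close>; the condition
    \<open>r t \<ge> 0\<close> excludes -1.\<close>
  have "r t = 1" if "X t \<in> sphere 0 1"
  proof -
    have "(r t)\<^sup>2 = (r t)\<^sup>2 * (?c\<^sup>2 + ?s\<^sup>2)"
      by simp
    also have "\<dots> = (norm (X t))\<^sup>2"
      unfolding power2_norm_eq_inner inner_vec_def sum_2 X[OF t] inner_real_def by algebra
    also have "\<dots> = 1"
      using that by simp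
    finally show ?thesis
      using assms(3)[OF t] by (simp add: power2_eq_1_iff)
  qed
  with radial tangential
  show "deriv r t = r t * radial A (\<theta> t) \<and>
      r t * deriv \<theta> t = r t * tangential A (\<theta> t) \<and>
      (X t \<in> sphere 0 1 \<longrightarrow>
        deriv \<theta> t = r t * deriv \<theta> t \<and>
        deriv r t = radial A (\<theta> t) \<and>
        deriv \<theta> t = tangential A (\<theta> t))"
    by auto
qed

end
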